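(* The operators $$\hat P=\frac{1}{Y'(x)^2}\big[Y(x)+c_0\big]\hat D_x^2+\frac{1}{Y'(x)^3}\Big[(c_1+3)Y'(x)^2-3(Y(x)+c_0)Y''(x)\Big]\hat D_x$$ $$\qquad-\frac{1}{Y'(x)^4}\Big[(Y(x)+c_0)\big(Y'''(x)Y'(x)-3Y''(x)^2\big)+(c_1+3)Y'(x)^2Y''(x)\Big],$$ $$\hat M=Y'(x)\,\hat D_x^{-1}+k_0$$ satisfy the Heisenberg relation $[\hat P,\hat M]=\hat 1$, and both $\hat P\hat M$ and $\hat M\hat P$ are second order differential operators. The function $Y(x)$ satisfies the condition $Y(x_0)=0$ and is otherwise arbitrary. The constants $c_0,c_1,x_0,k_0$ are arbitrary. The operators $\hat P$ and $\hat M$ are defined for functions $u(x)$ satisfying the boundary condition $$\left[\frac{1}{Y'(x)^3}\Big\{(Y(x)+c_0)\,Y'(x)\,u'(x)+\big[(2+c_1)Y'(x)^2-(Y(x)+c_0)Y''(x)\big]u(x)\Big\}\right]_{x=x_0}=0 .$$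
   Context: $x$ is a real variable, $\hat D_x=\frac{d}{dx}$, $\hat D_x^{-1}u(x)=\int_{x_0}^x u(\xi)\,d\xi$, primes denote derivatives with respect to $x$, and $[\hat P,\hat M]=\hat P\hat M-\hat M\hat P$. All functions appearing as coefficients of the operators are assumed sufficiently smooth.
   Formalization: For k_0 = 0 the products PM and MP are only first order (e.g. Y = x, x_0 = 0), so exact second order is asserted only for k_0 ≠ 0; for every k_0 the products are shown to be differential operators of order at most two. *)

theory Defs
  imports "HOL-Analysis.Analysis"
begin

(* The derivative is taken within the interval I, so that it is one-sided at an endpoint
   belonging to I; for open I it is the ordinary derivative.  All operators act on total
   functions, but only the values on I matter. *)
definition Dx :: "real set \<Rightarrow> (real \<Rightarrow> real) \<Rightarrow> real \<Rightarrow> real" where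
  "Dx I f = (\<lambda>x. vector_derivative f (at x within I))"

primrec Ck_on :: "nat \<Rightarrow> real set \<Rightarrow> (real \<Rightarrow> real) \<Rightarrow> bool" where
  "Ck_on 0 I f \<longleftrightarrow> continuous_on I f"
| "Ck_on (Suc n) I f \<longleftrightarrow> f differentiable_on I \<and> Ck_on n I (Dx I f)"

(* The interval integral is oriented: for x < x0 it is minus the integral over {x..x0}. *)
definition Dx_inv :: "real \<Rightarrow> (real \<Rightarrow> real) \<Rightarrow> real \<Rightarrow> real" where
  "Dx_inv x0 u = (\<lambda>x. LBINT \<xi>=ereal x0..ereal x. u \<xi>)"

definition opP ::
  "real set \<Rightarrow> (real \<Rightarrow> real) \<Rightarrow> real \<Rightarrow> real \<Rightarrow> (real \<Rightarrow> real) \<Rightarrow> real \<Rightarrow> real" where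
  "opP I Y c0 c1 u = (\<lambda>x.
     let Y1 = Dx I Y x; Y2 = Dx I (Dx I Y) x; Y3 = Dx I (Dx I (Dx I Y)) x in
       1 / Y1 ^ 2 * (Y x + c0) * Dx I (Dx I u) x
     + 1 / Y1 ^ 3 * ((c1 + 3) * Y1 ^ 2 - 3 * (Y x + c0) * Y2) * Dx I u x
     - 1 / Y1 ^ 4 * ((Y x + c0) * (Y3 * Y1 - 3 * Y2 ^ 2) + (c1 + 3) * Y1 ^ 2 * Y2) * u x)"

definition opM ::
  "real set \<Rightarrow> (real \<Rightarrow> real) \<Rightarrow> real \<Rightarrow> real \<Rightarrow> (real \<Rightarrow> real) \<Rightarrow> real \<Rightarrow> real" where
  "opM I Y x0 k0 u = (\<lambda>x. Dx I Y x * Dx_inv x0 u x + k0 * u x)"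

definition boundary_form ::
  "real set \<Rightarrow> (real \<Rightarrow> real) \<Rightarrow> real \<Rightarrow> real \<Rightarrow> (real \<Rightarrow> real) \<Rightarrow> real \<Rightarrow> real" where
  "boundary_form I Y c0 c1 u = (\<lambda>x.
     let Y1 = Dx I Y x; Y2 = Dx I (Dx I Y) x in
       1 / Y1 ^ 3 * ((Y x + c0) * Y1 * Dx I u x + ((2 + c1) * Y1 ^ 2 - (Y x + c0) * Y2) * u x))"

definition op_domain ::
  "real set \<Rightarrow> (real \<Rightarrow> real) \<Rightarrow> real \<Rightarrow> real \<Rightarrow> real \<Rightarrow> (real \<Rightarrow> real) set" where
  "op_domain I Y x0 c0 c1 = {u. Ck_on 2 I u \<and> boundary_form I Y c0 c1 u x0 = 0}"

definition commutator ::
  "((real \<Rightarrow> real) \<Rightarrow> real \<Rightarrow> real) \<Rightarrow> ((real \<Rightarrow> real) \<Rightarrow> real \<Rightarrow> real) \<Rightarrow> (real \<Rightarrow> real) \<Rightarrow> real \<Rightarrow> real"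
where
  "commutator A B u = (\<lambda>x. A (B u) x - B (A u) x)"

(* L acts on the functions in V as the differential expression with coefficients a 0, ..., a n.
   The coefficients are chosen before the function u. *)
definition represents_diff_op ::
  "real set \<Rightarrow> (real \<Rightarrow> real) set \<Rightarrow> nat \<Rightarrow> (nat \<Rightarrow> real \<Rightarrow> real)
     \<Rightarrow> ((real \<Rightarrow> real) \<Rightarrow> real \<Rightarrow> real) \<Rightarrow> bool" where
  "represents_diff_op I V n a L \<longleftrightarrow>
     (\<forall>k\<le>n. continuous_on I (a k)) \<and>
     (\<forall>u\<in>V. \<forall>x\<in>I. L u x = (\<Sum>k\<le>n. a k x * (Dx I ^^ k) u x))"

definition diff_op_order_le ::
  "real set \<Rightarrow> (real \<Rightarrow> real) set \<Rightarrow> nat \<Rightarrow> ((real \<Rightarrow> real) \<Rightarrow> real \<Rightarrow> real) \<Rightarrow> bool" where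
  "diff_op_order_le I V n L \<longleftrightarrow> (\<exists>a. represents_diff_op I V n a L)"

definition diff_op_order ::
  "real set \<Rightarrow> (real \<Rightarrow> real) set \<Rightarrow> nat \<Rightarrow> ((real \<Rightarrow> real) \<Rightarrow> real \<Rightarrow> real) \<Rightarrow> bool" where
  "diff_op_order I V n L \<longleftrightarrow> (\<exists>a. represents_diff_op I V n a L \<and> (\<exists>x\<in>I. a n x \<noteq> 0))"

end

theory Submission
  imports Defs
begin

text \<open>
  Write \<open>A = Y + c0\<close> and let \<open>F\<close> be the boundary form of \<open>u\<close>.  The coefficients of \<open>P\<close> make it
  the derivative of the boundary form, \<open>P u = F'\<close>, and they satisfy \<open>P Y' = 0\<close>, so that in
  \<open>P (Y' w)\<close> with \<open>w' = u\<close> the nonlocal term disappears and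
  \<open>A/Y' u' + (c1 + 3 - A Y''/Y'^2) u\<close> remains.  On the other side, the boundary condition gives
  \<open>Y' D^{-1} P u = Y' (F - F(x0)) = Y' F = A/Y' u' + (c1 + 2 - A Y''/Y'^2) u\<close>.  The two differ
  by \<open>u\<close>.  Both products have leading coefficient \<open>k0 A/Y'^2\<close>, and \<open>A\<close> cannot vanish identically
  because \<open>Y'\<close> does not vanish.
\<close>

section \<open>Differentiation and integration relative to an interval\<close>

lemma at_within_interval_neq_bot:
  fixes I :: "real set"
  assumes "is_interval I" "interior I \<noteq> {}" "x \<in> I"
  shows "at x within I \<noteq> bot"
proof -
  have "I \<noteq> {x}" using assms(2) by auto
  then have "x islimpt I"
    using assms connected_imp_perfect is_interval_connected by blast
  then show ?thesis by (simp add: trivial_limit_within)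
qed

text \<open>\<open>vector_derivative\<close> is a choice operator, so it yields a given value only
  where the derivative is unique. The nontrivial filter ensures this at each point of
  \<open>I\<close>, endpoints included.\<close>

lemma Dx_eqI:
  assumes "is_interval I" "interior I \<noteq> {}" "x \<in> I"
    and "(f has_real_derivative d) (at x within I)"
  shows "Dx I f x = d"
  using assms at_within_interval_neq_bot unfolding Dx_def
  by (intro vector_derivative_within) (auto simp: has_real_derivative_iff_has_vector_derivative)

lemma has_real_derivative_Dx:
  assumes "f differentiable_on I" "x \<in> I"
  shows "(f has_real_derivative Dx I f x) (at x within I)"
  using assms unfolding Dx_def has_real_derivative_iff_has_vector_derivative
  by (meson differentiable_on_def vector_derivative_works)

text \<open>\<open>Dx I f\<close> and \<open>f'\<close> need agree only on \<open>I\<close>, so the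
  second derivative is carried from one to the other by a transformation within
  \<open>I\<close>.\<close>

lemma Ck_on_2I:
  assumes I: "is_interval I" "interior I \<noteq> {}"
    and f: "\<And>x. x \<in> I \<Longrightarrow> (f has_real_derivative f' x) (at x within I)"
    and f': "\<And>x. x \<in> I \<Longrightarrow> (f' has_real_derivative f'' x) (at x within I)"
    and cont: "continuous_on I f''"
  shows "Ck_on 2 I f"
    and "x \<in> I \<Longrightarrow> Dx I f x = f' x"
    and "x \<in> I \<Longrightarrow> Dx I (Dx I f) x = f'' x"
proof -
  have D: "Dx I f x = f' x" if "x \<in> I" for x
    using Dx_eqI[OF I that f[OF that]] .
  have d2: "(Dx I f has_real_derivative f'' x) (at x within I)" if "x \<in> I" for x
    using f'[OF that] has_derivative_transform[OF that D] by (simp add: has_field_derivative_def)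
  have D2: "Dx I (Dx I f) x = f'' x" if "x \<in> I" for x
    using Dx_eqI[OF I that d2[OF that]] .
  have "continuous_on I (Dx I (Dx I f))"
    using cont D2 by (simp cong: continuous_on_cong)
  moreover have "f differentiable_on I" "Dx I f differentiable_on I"
    unfolding differentiable_on_def real_differentiable_def
    using f d2 by blast+
  ultimately show "Ck_on 2 I f" by (simp add: numeral_2_eq_2)
  show "x \<in> I \<Longrightarrow> Dx I f x = f' x" "x \<in> I \<Longrightarrow> Dx I (Dx I f) x = f'' x"
    by (fact D, fact D2)
qed

text \<open>The fundamental theorem is applied on a compact interval inside \<open>I\<close> that
  contains \<open>x0\<close> and \<open>x\<close> and coincides with \<open>I\<close> near
  \<open>x\<close>; the two filters at \<open>x\<close> are then equal.\<close>

lemma Dx_inv_has_real_derivative: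
  assumes I: "is_interval I" "x0 \<in> I" "x \<in> I" and u: "continuous_on I u"
  shows "(Dx_inv x0 u has_real_derivative u x) (at x within I)"
proof -
  \<comment> \<open>A point of \<open>I\<close> strictly to the left of \<open>x\<close>, or
    \<open>x\<close> itself if it is the left endpoint of \<open>I\<close>.\<close>
  obtain a' where a': "a' \<in> I" "a' \<le> x" "a' < x \<or> (\<forall>y\<in>I. x \<le> y)"
    using I(3) by (meson less_imp_le not_less order_refl)
  obtain b' where b': "b' \<in> I" "x \<le> b'" "x < b' \<or> (\<forall>y\<in>I. y \<le> x)"
    using I(3) by (meson less_imp_le not_less order_refl)
  define a where "a = min a' x0"
  define b where "b = max b' x0"
  have ab: "a \<in> I" "b \<in> I" "a \<le> x" "x \<le> b" "a \<le> x0" "x0 \<le> b" "a \<le> b"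
    using a' b' I(2) unfolding a_def b_def by (auto simp: min_def max_def)
  have sub: "{a..b} \<subseteq> I"
    using I(1) ab(1,2) by (meson atLeastAtMost_iff mem_is_interval_1_I subsetI)
  \<comment> \<open>On the window from \<open>l\<close> to \<open>r\<close> the sets
    \<open>I\<close> and \<open>{a..b}\<close> agree. At an endpoint of \<open>I\<close> any bound
    beyond \<open>x\<close> serves, hence the shift by 1.\<close>
  define l where "l = (if a' < x then a' else x - 1)"
  define r where "r = (if x < b' then b' else x + 1)"
  have "a \<le> y" "y \<le> b" if "y \<in> I" "l < y" "y < r" for y
  proof -
    have "a \<le> a'" "b' \<le> b" by (simp_all add: a_def b_def)
    moreover have "a' \<le> y" using that(1,2) a'(2,3) by (cases "a' < x") (auto simp: l_def)
    moreover have "y \<le> b'" using that(1,3) b'(2,3) by (cases "x < b'") (auto simp: r_def)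
    ultimately show "a \<le> y" "y \<le> b" by linarith+
  qed
  with sub have "{a..b} \<inter> {l<..<r} - {x} = I \<inter> {l<..<r} - {x}"
    by auto
  moreover have "x \<in> {l<..<r}" unfolding l_def r_def by auto
  ultimately have eq: "at x within {a..b} = at x within I"
    by (intro at_within_nhd[of x "{l<..<r}"]) auto
  have "((\<lambda>y. LBINT \<xi>=x0..y. u \<xi>) has_vector_derivative u x) (at x within {a..b})"
    using ab by (intro interval_integral_FTC2 continuous_on_subset[OF u sub]) auto
  then show ?thesis
    unfolding eq Dx_inv_def has_real_derivative_iff_has_vector_derivative .
qed

lemma Dx_inv_eqI:
  assumes I: "is_interval I" "x0 \<in> I" "x \<in> I"
    and F: "\<And>y. y \<in> I \<Longrightarrow> (F has_real_derivative f y) (at y within I)"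
    and f: "continuous_on I f"
  shows "Dx_inv x0 f x = F x - F x0"
proof -
  have sub: "{min x0 x..max x0 x} \<subseteq> I"
  proof -
    have "min x0 x \<in> I" "max x0 x \<in> I" using I by (auto simp: min_def max_def)
    then show ?thesis
      using I(1) by (meson atLeastAtMost_iff mem_is_interval_1_I subsetI)
  qed
  have "(F has_vector_derivative f y) (at y within {min x0 x..max x0 x})"
    if "min x0 x \<le> y" "y \<le> max x0 x" for y
  proof -
    have "y \<in> I" using sub that by auto
    from DERIV_subset[OF F[OF this] sub] show ?thesis
      by (simp add: has_real_derivative_iff_has_vector_derivative)
  qed
  then show ?thesis
    unfolding Dx_inv_def
    by (intro interval_integral_FTC_finite continuous_on_subset[OF f sub])
qed

section \<open>Algebraic identities behind the two products\<close>

lemma nonlocal_term_cancels: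
  fixes p :: real
  assumes "p \<noteq> 0"
  shows "1 / p ^ 2 * A * (r * w + 2 * q * u + p * d + k * d2)
      + 1 / p ^ 3 * (b * p ^ 2 - 3 * A * q) * (q * w + p * u + k * d)
      - 1 / p ^ 4 * (A * (r * p - 3 * q ^ 2) + b * p ^ 2 * q) * (p * w + k * u)
    = A / p * d + (b - A * q / p ^ 2) * u
      + k * (1 / p ^ 2 * A * d2 + 1 / p ^ 3 * (b * p ^ 2 - 3 * A * q) * d
        - 1 / p ^ 4 * (A * (r * p - 3 * q ^ 2) + b * p ^ 2 * q) * u)"
  using assms by (simp add: field_simps power2_eq_square power3_eq_cube power4_eq_xxxx)

text \<open>With p, q, r the first three derivatives of Y, A = Y + c0, b = c1 + 3 and v = 1/p, the
  left side is the product rule for v^3 times the bracket of the boundary form, using v' = - q v^2.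
  The right side is P u.\<close>

lemma boundary_form_derivative_identity:
  fixes p :: real
  assumes "p * v = 1"
  shows "3 * v ^ 2 * (- q * v ^ 2) * (A * p * d + ((b - 1) * p ^ 2 - A * q) * u)
      + v ^ 3 * (p * p * d + A * q * d + A * p * d2
        + (2 * (b - 1) * p * q - p * q - A * r) * u + ((b - 1) * p ^ 2 - A * q) * d)
    = v ^ 2 * A * d2 + v ^ 3 * (b * p ^ 2 - 3 * A * q) * d
      - v ^ 4 * (A * (r * p - 3 * q ^ 2) + b * p ^ 2 * q) * u"
proof -
  have "p \<noteq> 0" and v: "v = 1 / p"
    using assms by (auto simp: eq_divide_eq mult.commute)
  then show ?thesis
    unfolding v by (simp add: field_simps power2_eq_square power3_eq_cube power4_eq_xxxx)
qed

section \<open>Action of the operators and their products\<close>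

locale heisenberg_setting =
  fixes I :: "real set" and Y :: "real \<Rightarrow> real" and x0 c0 c1 k0 :: real
  assumes I: "is_interval I" "interior I \<noteq> {}" and x0: "x0 \<in> I"
    and Y: "Ck_on 3 I Y" and Y1_nz: "\<And>x. x \<in> I \<Longrightarrow> Dx I Y x \<noteq> 0"
begin

abbreviation "Y1 \<equiv> Dx I Y"
abbreviation "Y2 \<equiv> Dx I Y1"
abbreviation "Y3 \<equiv> Dx I Y2"

lemma Y_deriv:
  assumes "x \<in> I"
  shows "(Y has_real_derivative Y1 x) (at x within I)"
    and "(Y1 has_real_derivative Y2 x) (at x within I)"
    and "(Y2 has_real_derivative Y3 x) (at x within I)"
  using Y assms by (auto simp: numeral_3_eq_3 intro: has_real_derivative_Dx)

lemma Y_cont: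
  "continuous_on I Y" "continuous_on I Y1" "continuous_on I Y2" "continuous_on I Y3"
  using Y by (auto simp: numeral_3_eq_3 intro: differentiable_imp_continuous_on)

lemma Ck_on_2D:
  assumes "Ck_on 2 I u"
  shows "x \<in> I \<Longrightarrow> (u has_real_derivative Dx I u x) (at x within I)"
    and "x \<in> I \<Longrightarrow> (Dx I u has_real_derivative Dx I (Dx I u) x) (at x within I)"
    and "continuous_on I u" "continuous_on I (Dx I u)" "continuous_on I (Dx I (Dx I u))"
  using assms
  by (auto simp: numeral_2_eq_2 intro: has_real_derivative_Dx differentiable_imp_continuous_on)

text \<open>Since the antiderivative w satisfies w' = u, differentiating Y' w + k0 u twice involves
  Y up to its third derivative and u up to its second.\<close>

lemma opM_deriv:
  assumes u: "Ck_on 2 I u"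
  shows "Ck_on 2 I (opM I Y x0 k0 u)"
    and "x \<in> I \<Longrightarrow> Dx I (opM I Y x0 k0 u) x
           = Y2 x * Dx_inv x0 u x + Y1 x * u x + k0 * Dx I u x"
    and "x \<in> I \<Longrightarrow> Dx I (Dx I (opM I Y x0 k0 u)) x
           = Y3 x * Dx_inv x0 u x + 2 * Y2 x * u x + Y1 x * Dx I u x + k0 * Dx I (Dx I u) x"
proof -
  note u' = Ck_on_2D[OF u]
  have w: "(Dx_inv x0 u has_real_derivative u x) (at x within I)" if "x \<in> I" for x
    using Dx_inv_has_real_derivative[OF I(1) x0 that u'(3)] .
  then have wc: "continuous_on I (Dx_inv x0 u)"
    by (intro DERIV_continuous_on)
  have d1: "(opM I Y x0 k0 u has_real_derivative
      Y2 x * Dx_inv x0 u x + Y1 x * u x + k0 * Dx I u x) (at x within I)" if "x \<in> I" for x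
    unfolding opM_def using that
    by (auto intro!: derivative_eq_intros Y_deriv u' w)
  have d2: "((\<lambda>x. Y2 x * Dx_inv x0 u x + Y1 x * u x + k0 * Dx I u x) has_real_derivative
      Y3 x * Dx_inv x0 u x + 2 * Y2 x * u x + Y1 x * Dx I u x + k0 * Dx I (Dx I u) x)
      (at x within I)" if "x \<in> I" for x
    using that by (auto intro!: derivative_eq_intros Y_deriv u' w)
  have "continuous_on I (\<lambda>x. Y3 x * Dx_inv x0 u x + 2 * Y2 x * u x + Y1 x * Dx I u x
      + k0 * Dx I (Dx I u) x)"
    by (intro continuous_intros Y_cont u' wc)
  from Ck_on_2I[OF I d1 d2 this]
  show "Ck_on 2 I (opM I Y x0 k0 u)"
    and "x \<in> I \<Longrightarrow> Dx I (opM I Y x0 k0 u) x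
           = Y2 x * Dx_inv x0 u x + Y1 x * u x + k0 * Dx I u x"
    and "x \<in> I \<Longrightarrow> Dx I (Dx I (opM I Y x0 k0 u)) x
           = Y3 x * Dx_inv x0 u x + 2 * Y2 x * u x + Y1 x * Dx I u x + k0 * Dx I (Dx I u) x"
    by blast+
qed

text \<open>Continuity lets \<open>opM\<close> be applied after \<open>opP\<close>: the
  antiderivative of P u is then given by the fundamental theorem.\<close>

lemma opP_cont:
  assumes "Ck_on 2 I u"
  shows "continuous_on I (opP I Y c0 c1 u)"
  unfolding opP_def Let_def
  by (intro continuous_intros Y_cont Ck_on_2D[OF assms]) (auto simp: Y1_nz)

lemma opP_opM:
  assumes u: "Ck_on 2 I u" and x: "x \<in> I"
  shows "opP I Y c0 c1 (opM I Y x0 k0 u) x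
    = (Y x + c0) / Y1 x * Dx I u x + (c1 + 3 - (Y x + c0) * Y2 x / Y1 x ^ 2) * u x
      + k0 * opP I Y c0 c1 u x"
proof -
  note derivs = opM_deriv(2,3)[OF u x]
  show ?thesis
    \<comment> \<open>The equations \<open>derivs\<close> speak of \<open>opM\<close> folded, so
      they rewrite before \<open>opM\<close> is unfolded.\<close>
    unfolding opP_def Let_def derivs unfolding opM_def
    by (rule nonlocal_term_cancels[OF Y1_nz[OF x]])
qed

lemma boundary_form_deriv:
  assumes u: "Ck_on 2 I u" and x: "x \<in> I"
  shows "(boundary_form I Y c0 c1 u has_real_derivative opP I Y c0 c1 u x) (at x within I)"
proof -
  \<comment> \<open>Powers of 1/Y' in place of quotients leave only the product and power rules, and
    a polynomial identity under p v = 1.\<close>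
  define V where "V = (\<lambda>y. 1 / Y1 y)"
  define A p q r b d v where "A = Y x + c0" and "p = Y1 x" and "q = Y2 x" and "r = Y3 x"
    and "b = c1 + 3" and "d = Dx I u x" and "v = V x"
  note defs = A_def p_def q_def r_def b_def d_def v_def
  have pv: "p * v = 1" using Y1_nz[OF x] by (simp add: defs V_def)
  have dV: "(V has_real_derivative - q * v\<^sup>2) (at x within I)"
    unfolding defs V_def using Y1_nz[OF x]
    by (auto intro!: derivative_eq_intros Y_deriv x simp: power2_eq_square)
  have eq: "boundary_form I Y c0 c1 u = (\<lambda>y. V y ^ 3 *
      ((Y y + c0) * Y1 y * Dx I u y + ((2 + c1) * Y1 y ^ 2 - (Y y + c0) * Y2 y) * u y))"
    by (simp add: boundary_form_def Let_def V_def power_one_over)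
  have "(boundary_form I Y c0 c1 u has_real_derivative
      3 * v\<^sup>2 * (- q * v\<^sup>2) * (A * p * d + ((b - 1) * p\<^sup>2 - A * q) * u x)
      + v ^ 3 * (p * p * d + A * q * d + A * p * Dx I (Dx I u) x
          + (2 * (b - 1) * p * q - p * q - A * r) * u x + ((b - 1) * p\<^sup>2 - A * q) * d))
      (at x within I)"
    unfolding eq
    by (rule derivative_eq_intros Y_deriv x Ck_on_2D[OF u] dV refl)+
      (simp add: defs algebra_simps)
  also have "3 * v\<^sup>2 * (- q * v\<^sup>2) * (A * p * d + ((b - 1) * p\<^sup>2 - A * q) * u x)
      + v ^ 3 * (p * p * d + A * q * d + A * p * Dx I (Dx I u) x
          + (2 * (b - 1) * p * q - p * q - A * r) * u x + ((b - 1) * p\<^sup>2 - A * q) * d)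
    = v\<^sup>2 * A * Dx I (Dx I u) x + v ^ 3 * (b * p\<^sup>2 - 3 * A * q) * d
      - v ^ 4 * (A * (r * p - 3 * q\<^sup>2) + b * p\<^sup>2 * q) * u x"
    by (rule boundary_form_derivative_identity[OF pv])
  also have "\<dots> = opP I Y c0 c1 u x"
    by (simp add: opP_def Let_def defs V_def power_one_over)
  finally show ?thesis .
qed

lemma opM_opP:
  assumes u: "u \<in> op_domain I Y x0 c0 c1" and x: "x \<in> I"
  shows "opM I Y x0 k0 (opP I Y c0 c1 u) x
    = (Y x + c0) / Y1 x * Dx I u x + (c1 + 2 - (Y x + c0) * Y2 x / Y1 x ^ 2) * u x
      + k0 * opP I Y c0 c1 u x"
proof -
  have C: "Ck_on 2 I u" and b: "boundary_form I Y c0 c1 u x0 = 0"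
    using u by (auto simp: op_domain_def)
  have "Dx_inv x0 (opP I Y c0 c1 u) x = boundary_form I Y c0 c1 u x"
    using Dx_inv_eqI[OF I(1) x0 x boundary_form_deriv[OF C] opP_cont[OF C]] b by simp
  then have "opM I Y x0 k0 (opP I Y c0 c1 u) x
      = Y1 x * boundary_form I Y c0 c1 u x + k0 * opP I Y c0 c1 u x"
    by (simp add: opM_def)
  then show ?thesis
    unfolding boundary_form_def Let_def
    using Y1_nz[OF x] by (simp add: field_simps power2_eq_square power3_eq_cube)
qed

section \<open>Both products as differential operators of order two\<close>

definition product_coeff :: "real \<Rightarrow> nat \<Rightarrow> real \<Rightarrow> real" where
  "product_coeff e k x =
     (if k = 0 then e - (Y x + c0) * Y2 x / Y1 x ^ 2
        - k0 * (1 / Y1 x ^ 4 * ((Y x + c0) * (Y3 x * Y1 x - 3 * Y2 x ^ 2) + (c1 + 3) * Y1 x ^ 2 * Y2 x))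
      else if k = 1 then (Y x + c0) / Y1 x
        + k0 * (1 / Y1 x ^ 3 * ((c1 + 3) * Y1 x ^ 2 - 3 * (Y x + c0) * Y2 x))
      else k0 * (1 / Y1 x ^ 2 * (Y x + c0)))"

text \<open>The assumed form is common to both products, which differ only in the constant
  \<open>e\<close>. Expanding P u and sorting by the order of the derivative gives coefficients
  independent of u.\<close>

lemma represents_product:
  assumes "\<And>u x. u \<in> V \<Longrightarrow> x \<in> I \<Longrightarrow>
    L u x = (Y x + c0) / Y1 x * Dx I u x + (e - (Y x + c0) * Y2 x / Y1 x ^ 2) * u x
      + k0 * opP I Y c0 c1 u x"
  shows "represents_diff_op I V 2 (product_coeff e) L"
  unfolding represents_diff_op_def
proof (intro conjI ballI allI impI)
  fix k :: nat
  show "continuous_on I (product_coeff e k)"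
    unfolding product_coeff_def
    by (cases "k = 0"; cases "k = 1"; simp)
      (intro continuous_intros Y_cont; auto simp: Y1_nz)+
next
  fix u x assume "u \<in> V" "x \<in> I"
  then show "L u x = (\<Sum>k\<le>2. product_coeff e k x * (Dx I ^^ k) u x)"
    unfolding assms[OF \<open>u \<in> V\<close> \<open>x \<in> I\<close>] opP_def Let_def
    by (simp add: numeral_2_eq_2 product_coeff_def algebra_simps)
qed

lemma product_coeff_2_nonzero:
  assumes "k0 \<noteq> 0"
  shows "\<exists>x\<in>I. product_coeff e 2 x \<noteq> 0"
proof (rule ccontr)
  assume "\<not> ?thesis"
  then have const: "Y x = - c0" if "x \<in> I" for x
    using that assms Y1_nz[OF that] by (auto simp: product_coeff_def add_eq_0_iff2)
  \<comment> \<open>Constancy on \<open>I\<close> determines the derivative within \<open>I\<close>,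
    so Y' would vanish at \<open>x0\<close>.\<close>
  have "(Y has_real_derivative 0) (at x0 within I)"
    using has_derivative_transform[OF x0 const has_derivative_const] by (simp add: has_field_derivative_def lambda_zero)
  then show False
    using Dx_eqI[OF I x0] Y1_nz[OF x0] by blast
qed

end

theorem theorem1:
  fixes I :: "real set" and Y :: "real \<Rightarrow> real" and x0 c0 c1 k0 :: real
  assumes "is_interval I" and "interior I \<noteq> {}" and "x0 \<in> I"
    and "Ck_on 3 I Y"
    and "\<forall>x\<in>I. Dx I Y x \<noteq> 0"
    and "Y x0 = 0"
  shows "(\<forall>u\<in>op_domain I Y x0 c0 c1.
            Ck_on 2 I (opM I Y x0 k0 u) \<and> Ck_on 0 I (opP I Y c0 c1 u) \<and>
            (\<forall>x\<in>I. commutator (opP I Y c0 c1) (opM I Y x0 k0) u x = u x)) \<and>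
         diff_op_order_le I (op_domain I Y x0 c0 c1) 2 (opP I Y c0 c1 \<circ> opM I Y x0 k0) \<and>
         diff_op_order_le I (op_domain I Y x0 c0 c1) 2 (opM I Y x0 k0 \<circ> opP I Y c0 c1) \<and>
         (k0 \<noteq> 0 \<longrightarrow>
           diff_op_order I (op_domain I Y x0 c0 c1) 2 (opP I Y c0 c1 \<circ> opM I Y x0 k0) \<and>
           diff_op_order I (op_domain I Y x0 c0 c1) 2 (opM I Y x0 k0 \<circ> opP I Y c0 c1))"
proof -
  interpret heisenberg_setting I Y x0 c0 c1 k0
    using assms by unfold_locales auto
  let ?V = "op_domain I Y x0 c0 c1"
  have C: "Ck_on 2 I u" if "u \<in> ?V" for u
    using that by (simp add: op_domain_def)
  have PM: "represents_diff_op I ?V 2 (product_coeff (c1 + 3)) (opP I Y c0 c1 \<circ> opM I Y x0 k0)"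
    using C by (intro represents_product) (simp add: opP_opM)
  have MP: "represents_diff_op I ?V 2 (product_coeff (c1 + 2)) (opM I Y x0 k0 \<circ> opP I Y c0 c1)"
    by (intro represents_product) (simp add: opM_opP)
  \<comment> \<open>The terms \<open>k0\<close> P u cancel, and the zeroth-order constants c1 + 3
    and c1 + 2 leave exactly u.\<close>
  have "commutator (opP I Y c0 c1) (opM I Y x0 k0) u x = u x" if "u \<in> ?V" "x \<in> I" for u x
    unfolding commutator_def opP_opM[OF C[OF that(1)] that(2)] opM_opP[OF that]
    by (simp add: algebra_simps)
  then show ?thesis
    using C opM_deriv(1) opP_cont PM MP product_coeff_2_nonzero
    unfolding diff_op_order_def diff_op_order_le_def by auto
qed

end
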